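(* Let $f:\mathbb{R}^n\to\mathbb{R}$ and $c:\mathbb{R}^n\to\mathbb{R}^m$ be twice continuously differentiable. Consider the problem (NLP) $\min_x f(x)$ s.t. $c(x)\ge0$ and its squared-slack reformulation (SSV) $\min_{x,v} f(x)$ s.t. $c(x)-v\odot v=0$, $v\in\mathbb{R}^m$. If $(x,v,s)\in\mathbb{R}^n\times\mathbb{R}^m\times\mathbb{R}^m$ is a 2N point of (SSV), then $(x,s)$ is a weak 2N point for (NLP). Conversely, if $(x,s)$ is a weak 2N point for (NLP), then any point $(x,v,s)$ with $v_i^2=c_i(x)$, $i=1,\dots,m$, is a 2N point for (SSV).
   Context: $\odot$ is the componentwise product. The Lagrangians are $\mathcal{L}_o(x,s)=f(x)-\sum_{i=1}^m s_ic_i(x)$ for (NLP) and $\mathcal{L}(x,v,s)=f(x)-\sum_{i=1}^m s_i(c_i(x)-v_i^2)$ for (SSV). Weak 2N point for (NLP): $(x,s)\in\mathbb{R}^n\times\mathbb{R}^m$ such that the KKT conditions $\nabla f(x)-\sum_{i=1}^m s_i\nabla c_i(x)=0$, $s\ge0$, $c(x)\ge0$, $s_ic_i(x)=0$ for $i=1,\dots,m$ hold, and $w^T\nabla^2_{xx}\mathcal{L}_o(x,s)w\ge0$ for all $w\in\mathbb{R}^n$ with $\nabla c_i(x)^Tw=0$ for $i\in\mathcal{A}\cup\mathcal{D}$. Here $\mathcal{A}=\{i: c_i(x)=0,\ s_i>0\}$ and $\mathcal{D}=\{i: c_i(x)=0,\ s_i=0\}$ (and $\mathcal{I}=\{i: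 c_i(x)>0,\ s_i=0\}$ is the remaining index set). 2N point for (SSV): $(x,v,s)\in\mathbb{R}^n\times\mathbb{R}^m\times\mathbb{R}^m$ such that the KKT conditions $\nabla f(x)-\sum_{i=1}^m s_i\nabla c_i(x)=0$, $2s\odot v=0$, $c_i(x)=v_i^2$ for $i=1,\dots,m$ hold, and for all $(w,z)\in\mathbb{R}^{n+m}$ with $\nabla c_i(x)^Tw=2v_iz_i$, $i=1,\dots,m$, we have $w^T\nabla^2_{xx}\mathcal{L}(x,v,s)w+2\sum_{i=1}^m s_iz_i^2\ge0$. *)

theory Defs
  imports "HOL-Analysis.Analysis"
begin

text \<open>Twice continuously (Frechet) differentiable on the whole space.\<close>

definition C2 :: "('a::real_normed_vector \<Rightarrow> 'b::real_normed_vector) \<Rightarrow> bool" where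
  "C2 f \<longleftrightarrow>
     (\<exists>(f' :: 'a \<Rightarrow> 'a \<Rightarrow>\<^sub>L 'b) (f'' :: 'a \<Rightarrow> 'a \<Rightarrow>\<^sub>L ('a \<Rightarrow>\<^sub>L 'b)).
        (\<forall>x. (f has_derivative blinfun_apply (f' x)) (at x)) \<and>
        (\<forall>x. (f' has_derivative blinfun_apply (f'' x)) (at x)) \<and>
        continuous_on UNIV f'')"

definition gradient :: "(real ^ 'n \<Rightarrow> real) \<Rightarrow> real ^ 'n \<Rightarrow> real ^ 'n" where
  "gradient f x = (\<chi> i. frechet_derivative f (at x) (axis i 1))"

definition hessian :: "(real ^ 'n \<Rightarrow> real) \<Rightarrow> real ^ 'n \<Rightarrow> real ^ 'n ^ 'n" where
  "hessian f x = jacobian (gradient f) (at x)"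

text \<open>
  Both are total functions built on \<^const>\<open>frechet_derivative\<close>, hence meaningful only where the
  derivatives exist; the next lemmas show that for \<^const>\<open>C2\<close> functions they are the usual ones.
\<close>

lemma gradient_eqI:
  fixes f :: "real ^ 'n \<Rightarrow> real"
  assumes "GDERIV f x :> g"
  shows "gradient f x = g"
proof -
  have "(f has_derivative (\<lambda>h. h \<bullet> g)) (at x)"
    using assms by (simp add: gderiv_def)
  then have "(\<lambda>h. h \<bullet> g) = frechet_derivative f (at x)"
    by (rule frechet_derivative_at)
  then have "frechet_derivative f (at x) (axis i 1) = g $ i" for i
    by (metis inner_axis' inner_real_def mult_1)
  then show ?thesis
    by (simp add: gradient_def vec_eq_iff)
qed

lemma gderiv_gradient:
  fixes f :: "real ^ 'n \<Rightarrow> real"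
  assumes "f differentiable (at x)"
  shows "GDERIV f x :> gradient f x"
proof -
  let ?D = "frechet_derivative f (at x)"
  have D: "(f has_derivative ?D) (at x)"
    using assms by (simp add: frechet_derivative_works)
  then interpret bounded_linear ?D
    by (rule has_derivative_bounded_linear)
  have "?D h = h \<bullet> gradient f x" for h
  proof -
    have "?D h = ?D (\<Sum>i\<in>UNIV. (h $ i) *\<^sub>R axis i 1)"
      by (simp add: basis_expansion flip: scalar_mult_eq_scaleR)
    also have "\<dots> = h \<bullet> gradient f x"
      by (simp add: sum scaleR gradient_def inner_vec_def)
    finally show ?thesis .
  qed
  then have "?D = (\<lambda>h. h \<bullet> gradient f x)" ..
  with D show ?thesis
    by (simp only: gderiv_def)
qed

lemma C2_gradient_has_derivative:
  fixes f :: "real ^ 'n \<Rightarrow> real"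
  assumes "C2 f"
  shows "(gradient f has_derivative (\<lambda>h. hessian f x *v h)) (at x)"
proof -
  obtain f' :: "real ^ 'n \<Rightarrow> (real ^ 'n) \<Rightarrow>\<^sub>L real" and f''
    where f': "\<And>x. (f has_derivative blinfun_apply (f' x)) (at x)"
      and f'': "\<And>x. (f' has_derivative blinfun_apply (f'' x)) (at x)"
    using assms unfolding C2_def by blast
  have "gradient f = (\<lambda>y. \<chi> i. blinfun_apply (f' y) (axis i 1))"
    using frechet_derivative_at[OF f'] by (auto simp: gradient_def fun_eq_iff vec_eq_iff)
  moreover have "(\<lambda>y. blinfun_apply (f' y) (axis i 1)) differentiable (at x)" for i
    using blinfun.FDERIV[OF f'' has_derivative_const] by (rule differentiableI)
  then have "(\<lambda>y. \<chi> i. blinfun_apply (f' y) (axis i 1)) differentiable (at x)"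
    by (subst differentiable_componentwise_within) (auto simp: Basis_vec_def inner_axis)
  ultimately show ?thesis
    by (simp add: hessian_def jacobian_works)
qed

definition nlp_lagrangian ::
  "(real ^ 'n \<Rightarrow> real) \<Rightarrow> (real ^ 'n \<Rightarrow> real ^ 'm) \<Rightarrow> real ^ 'n \<Rightarrow> real ^ 'm \<Rightarrow> real" where
  "nlp_lagrangian f c x s = f x - (\<Sum>i\<in>UNIV. s $ i * c x $ i)"

definition ssv_lagrangian ::
  "(real ^ 'n \<Rightarrow> real) \<Rightarrow> (real ^ 'n \<Rightarrow> real ^ 'm) \<Rightarrow> real ^ 'n \<Rightarrow> real ^ 'm \<Rightarrow> real ^ 'm \<Rightarrow> real" where
  "ssv_lagrangian f c x v s = f x - (\<Sum>i\<in>UNIV. s $ i * (c x $ i - (v $ i)\<^sup>2))"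

definition strongly_active :: "(real ^ 'n \<Rightarrow> real ^ 'm) \<Rightarrow> real ^ 'n \<Rightarrow> real ^ 'm \<Rightarrow> 'm set" where
  "strongly_active c x s = {i. c x $ i = 0 \<and> s $ i > 0}"

definition degenerate :: "(real ^ 'n \<Rightarrow> real ^ 'm) \<Rightarrow> real ^ 'n \<Rightarrow> real ^ 'm \<Rightarrow> 'm set" where
  "degenerate c x s = {i. c x $ i = 0 \<and> s $ i = 0}"

definition nlp_KKT ::
  "(real ^ 'n \<Rightarrow> real) \<Rightarrow> (real ^ 'n \<Rightarrow> real ^ 'm) \<Rightarrow> real ^ 'n \<Rightarrow> real ^ 'm \<Rightarrow> bool" where
  "nlp_KKT f c x s \<longleftrightarrow>
     gradient f x - (\<Sum>i\<in>UNIV. s $ i *\<^sub>R gradient (\<lambda>y. c y $ i) x) = 0 \<and>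
     (\<forall>i. s $ i \<ge> 0) \<and> (\<forall>i. c x $ i \<ge> 0) \<and> (\<forall>i. s $ i * c x $ i = 0)"

definition nlp_weak_2N ::
  "(real ^ 'n \<Rightarrow> real) \<Rightarrow> (real ^ 'n \<Rightarrow> real ^ 'm) \<Rightarrow> real ^ 'n \<Rightarrow> real ^ 'm \<Rightarrow> bool" where
  "nlp_weak_2N f c x s \<longleftrightarrow>
     nlp_KKT f c x s \<and>
     (\<forall>w. (\<forall>i \<in> strongly_active c x s \<union> degenerate c x s. gradient (\<lambda>y. c y $ i) x \<bullet> w = 0) \<longrightarrow>
        w \<bullet> (hessian (\<lambda>y. nlp_lagrangian f c y s) x *v w) \<ge> 0)"

text \<open>Multiplication on \<^typ>\<open>real ^ 'm\<close> is componentwise.\<close>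

definition ssv_KKT ::
  "(real ^ 'n \<Rightarrow> real) \<Rightarrow> (real ^ 'n \<Rightarrow> real ^ 'm) \<Rightarrow> real ^ 'n \<Rightarrow> real ^ 'm \<Rightarrow> real ^ 'm \<Rightarrow> bool" where
  "ssv_KKT f c x v s \<longleftrightarrow>
     gradient f x - (\<Sum>i\<in>UNIV. s $ i *\<^sub>R gradient (\<lambda>y. c y $ i) x) = 0 \<and>
     2 *\<^sub>R (s * v) = 0 \<and> (\<forall>i. c x $ i = (v $ i)\<^sup>2)"

definition ssv_2N ::
  "(real ^ 'n \<Rightarrow> real) \<Rightarrow> (real ^ 'n \<Rightarrow> real ^ 'm) \<Rightarrow> real ^ 'n \<Rightarrow> real ^ 'm \<Rightarrow> real ^ 'm \<Rightarrow> bool" where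
  "ssv_2N f c x v s \<longleftrightarrow>
     ssv_KKT f c x v s \<and>
     (\<forall>w z. (\<forall>i. gradient (\<lambda>y. c y $ i) x \<bullet> w = 2 * v $ i * z $ i) \<longrightarrow>
        w \<bullet> (hessian (\<lambda>y. ssv_lagrangian f c y v s) x *v w) + 2 * (\<Sum>i\<in>UNIV. s $ i * (z $ i)\<^sup>2) \<ge> 0)"

end

theory Submission
  imports Defs
begin

text \<open>
  For fixed \<open>v\<close> and \<open>s\<close> the Lagrangian of (SSV) is that
  of (NLP) plus the constant \<open>\<Sum>\<^sub>i s\<^sub>i v\<^sub>i\<^sup>2\<close>, so both have the same Hessian in \<open>x\<close>
  (\<open>hessian_ssv_lagrangian\<close>); and since \<open>c\<^sub>i(x) = v\<^sub>i\<^sup>2\<close>, a constraint is active exactly when its slack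
  vanishes. What the squared slacks lose at first order is the sign of the multipliers, and what
  they add at second order is the term \<open>2 \<Sum>\<^sub>i s\<^sub>i z\<^sub>i\<^sup>2\<close>. These two compensate each other.

  From (SSV) to (NLP), the sign is recovered from the second-order condition: where \<open>v\<^sub>i = 0\<close>, moving
  the slack alone (\<open>w = 0\<close>, \<open>z = e\<^sub>i\<close>) is a feasible direction of curvature \<open>2 s\<^sub>i\<close>
  (\<open>ssv_2N_multiplier_nonneg\<close>). A direction \<open>w\<close> orthogonal to the active gradients extends to a
  feasible \<open>(w, z)\<close> with \<open>z\<^sub>i = \<nabla>c\<^sub>i(x)\<^sup>T w / (2 v\<^sub>i)\<close> on the inactive constraints and \<open>z\<^sub>i = 0\<close> on the
  active ones; every summand of the added term then vanishes because \<open>s\<^sub>i = 0\<close> whenever \<open>v\<^sub>i \<noteq> 0\<close>.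

  From (NLP) to (SSV), the linearized constraints force \<open>\<nabla>c\<^sub>i(x)\<^sup>T w = 2 v\<^sub>i z\<^sub>i = 0\<close> at every active
  constraint, so \<open>w\<close> is a direction covered by the weak 2N condition, and the added term is
  nonnegative because \<open>s \<ge> 0\<close>.
\<close>

lemma gradient_add_const: "gradient (\<lambda>y. g y + k) = gradient g"
proof -
  have "((\<lambda>y. g y + k) has_derivative D) (at x) \<longleftrightarrow> (g has_derivative D) (at x)" for D x
    using has_derivative_add_const[of g D "at x" k]
      has_derivative_add_const[of "\<lambda>y. g y + k" D "at x" "- k"] by auto
  then show ?thesis
    by (simp add: fun_eq_iff gradient_def frechet_derivative_def)
qed

lemma hessian_add_const: "hessian (\<lambda>y. g y + k) = hessian g"
  by (simp add: fun_eq_iff hessian_def gradient_add_const)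

lemma hessian_ssv_lagrangian:
  "hessian (\<lambda>y. ssv_lagrangian f c y v s) = hessian (\<lambda>y. nlp_lagrangian f c y s)"
proof -
  have "(\<lambda>y. ssv_lagrangian f c y v s) =
      (\<lambda>y. nlp_lagrangian f c y s + (\<Sum>i\<in>UNIV. s $ i * (v $ i)\<^sup>2))"
    by (simp add: fun_eq_iff ssv_lagrangian_def nlp_lagrangian_def algebra_simps sum_subtractf)
  then show ?thesis
    by (simp add: hessian_add_const)
qed

lemma ssv_KKT_complementary:
  assumes "ssv_KKT f c x v s"
  shows "s $ i = 0 \<or> v $ i = 0"
proof -
  have "(s * v) $ i = 0"
    using assms by (simp add: ssv_KKT_def)
  then show ?thesis
    by simp
qed

lemma strongly_active_Un_degenerate:
  assumes "\<And>i. s $ i \<ge> 0"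
  shows "strongly_active c x s \<union> degenerate c x s = {i. c x $ i = 0}"
  using assms by (auto simp: strongly_active_def degenerate_def less_le)

text \<open>
  The first-order conditions of (SSV) say nothing about the sign of a multiplier. Where \<open>v\<^sub>i \<noteq> 0\<close> it
  is zero by complementarity; where \<open>v\<^sub>i = 0\<close> the linearized constraint leaves the
  slack free to move, and a negative multiplier would give negative curvature along it.
\<close>

lemma ssv_2N_multiplier_nonneg:
  assumes "ssv_2N f c x v s"
  shows "s $ i \<ge> 0"
proof (cases "v $ i = 0")
  case True
  have "gradient (\<lambda>y. c y $ j) x \<bullet> 0 = 2 * v $ j * axis i 1 $ j" for j
    using True by (simp add: axis_def)
  then have "0 \<le> 0 \<bullet> (hessian (\<lambda>y. ssv_lagrangian f c y v s) x *v 0)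
      + 2 * (\<Sum>j\<in>UNIV. s $ j * (axis i 1 $ j)\<^sup>2)"
    using assms unfolding ssv_2N_def by blast
  also have "(\<Sum>j\<in>UNIV. s $ j * (axis i 1 $ j)\<^sup>2) = (\<Sum>j\<in>UNIV. if j = i then s $ j else 0)"
    by (intro sum.cong) (auto simp: axis_def)
  finally show ?thesis
    by simp
next
  case False
  then show ?thesis
    using assms ssv_KKT_complementary[of f c x v s i] by (auto simp: ssv_2N_def)
qed

lemma ssv_2N_imp_nlp_weak_2N:
  assumes "ssv_2N f c x v s"
  shows "nlp_weak_2N f c x s"
proof -
  have KKT: "ssv_KKT f c x v s"
    using assms by (simp add: ssv_2N_def)
  have s_nonneg: "s $ i \<ge> 0" for i
    using assms by (rule ssv_2N_multiplier_nonneg)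
  have c_eq: "c x $ i = (v $ i)\<^sup>2" for i
    using KKT by (simp add: ssv_KKT_def)
  have comp: "s $ i = 0 \<or> v $ i = 0" for i
    using KKT by (rule ssv_KKT_complementary)
  have "s $ i * c x $ i = 0" for i
    using comp[of i] c_eq[of i] by auto
  then have "nlp_KKT f c x s"
    using KKT s_nonneg by (simp add: nlp_KKT_def ssv_KKT_def)
  moreover have "w \<bullet> (hessian (\<lambda>y. nlp_lagrangian f c y s) x *v w) \<ge> 0"
    if "\<forall>i \<in> strongly_active c x s \<union> degenerate c x s. gradient (\<lambda>y. c y $ i) x \<bullet> w = 0" for w
  proof -
    \<comment> \<open>Since \<open>a / 0 = 0\<close>, this sets \<open>z\<^sub>i = 0\<close> on the active constraints.\<close>
    define z where "z = (\<chi> i. gradient (\<lambda>y. c y $ i) x \<bullet> w / (2 * v $ i))"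
    have "gradient (\<lambda>y. c y $ i) x \<bullet> w = 2 * v $ i * z $ i" for i
      using that s_nonneg c_eq[of i]
      by (cases "v $ i = 0") (simp_all add: strongly_active_Un_degenerate z_def)
    then have "0 \<le> w \<bullet> (hessian (\<lambda>y. ssv_lagrangian f c y v s) x *v w)
        + 2 * (\<Sum>i\<in>UNIV. s $ i * (z $ i)\<^sup>2)"
      using assms unfolding ssv_2N_def by blast
    moreover have "s $ i * (z $ i)\<^sup>2 = 0" for i
      using comp[of i] by (auto simp: z_def)
    ultimately show ?thesis
      by (simp add: hessian_ssv_lagrangian)
  qed
  ultimately show ?thesis
    by (simp add: nlp_weak_2N_def)
qed

lemma nlp_weak_2N_imp_ssv_2N:
  assumes weak: "nlp_weak_2N f c x s" and v: "\<And>i. (v $ i)\<^sup>2 = c x $ i"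
  shows "ssv_2N f c x v s"
proof -
  have KKT: "nlp_KKT f c x s"
    using weak by (simp add: nlp_weak_2N_def)
  then have s_nonneg: "s $ i \<ge> 0" for i
    by (simp add: nlp_KKT_def)
  have "s $ i * (v $ i)\<^sup>2 = 0" for i
    using KKT by (simp add: nlp_KKT_def v)
  then have "s * v = 0"
    by (simp add: vec_eq_iff)
  then have "ssv_KKT f c x v s"
    using KKT by (simp add: nlp_KKT_def ssv_KKT_def v)
  moreover have "w \<bullet> (hessian (\<lambda>y. ssv_lagrangian f c y v s) x *v w)
      + 2 * (\<Sum>i\<in>UNIV. s $ i * (z $ i)\<^sup>2) \<ge> 0"
    if feasible: "\<forall>i. gradient (\<lambda>y. c y $ i) x \<bullet> w = 2 * v $ i * z $ i" for w z
  proof -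
    have "gradient (\<lambda>y. c y $ i) x \<bullet> w = 0" if "c x $ i = 0" for i
      using feasible that v[of i] by simp
    then have "w \<bullet> (hessian (\<lambda>y. nlp_lagrangian f c y s) x *v w) \<ge> 0"
      using weak s_nonneg by (simp add: nlp_weak_2N_def strongly_active_Un_degenerate)
    moreover have "(\<Sum>i\<in>UNIV. s $ i * (z $ i)\<^sup>2) \<ge> 0"
      by (intro sum_nonneg mult_nonneg_nonneg s_nonneg zero_le_power2)
    ultimately show ?thesis
      by (simp add: hessian_ssv_lagrangian)
  qed
  ultimately show ?thesis
    by (simp add: ssv_2N_def)
qed

theorem theorem3p3:
  fixes f :: "real ^ 'n \<Rightarrow> real" and c :: "real ^ 'n \<Rightarrow> real ^ 'm"
  assumes "C2 f" and "C2 c"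
  shows "(\<forall>x v s. ssv_2N f c x v s \<longrightarrow> nlp_weak_2N f c x s) \<and>
         (\<forall>x s. nlp_weak_2N f c x s \<longrightarrow>
            (\<forall>v. (\<forall>i. (v $ i)\<^sup>2 = c x $ i) \<longrightarrow> ssv_2N f c x v s))"
  using ssv_2N_imp_nlp_weak_2N nlp_weak_2N_imp_ssv_2N by blast

end
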